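(* Let $\bm F\in\mathbb R^{n\times m}$ and $Z=\{0,1\}^n$. The number of nodes in the exact decision diagram for $X_{\bm F}$ (defined in the context) is $\mathcal O(n^m)$, where $m$ is treated as a constant; that is, for each fixed $m\geq 1$ there is a constant $C_m$ such that for every $n\ge1$ and every $\bm F\in\mathbb R^{n\times m}$ the exact decision diagram has at most $C_m n^m$ nodes.
   Context: $X_{\bm F}=\{(x_0,\bm x,\bm z)\in\mathbb R\times\mathbb R^n\times\{0,1\}^n:\ \|\bm F^\top\bm x\|_2^2\le x_0,\ x_i(1-z_i)=0\ \forall i\}$. For a matrix $\bm H$, $\bm H_\downarrow$ denotes $\bm H$ with its first row deleted. The exact decision diagram for $X_{\bm F}$ (case $Z=\{0,1\}^n$) is a layered directed multigraph with layers $1,\dots,n+1$. Layer 1 contains one node, storing the matrix $\bm F$. Nodes of layer $\ell$ are identified with the matrices $\bm H\in\mathbb R^{(n+1-\ell)\times m}$ they store (equal matrices in the same layer are the same node; at layer $n+1$ there is the single empty matrix). From each node $\bm H$ of layer $\ell\le n$, with first row $\bm u^\top$, there are two arcs to layer $\ell+1$, one for each decision $\bar z\in\{0,1\}$: if $\bar z=0$, or if $\bar z=1$ and $\bm u=\bm 0$, the head is $\bm H_\downarrow$; if $\bar z=1$ and $\bm u\neq\bm 0$, the head is $\bm H_\downarrow(\bm I-\bm u\bm u^\top/\|\bm u\|_2^2)$. The nodes of the diagram are all those reachable from layer 1. *)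

theory Defs
  imports Complex_Main "Jordan_Normal_Form.Matrix" "Graph_Theory.Digraph"
begin

definition drop_first_row :: "'a mat \<Rightarrow> 'a mat" where
  "drop_first_row H = mat (dim_row H - 1) (dim_col H) (\<lambda>(i, j). H $$ (Suc i, j))"

text \<open>The matrix \<open>I - u u\<^sup>T / \<parallel>u\<parallel>\<^sup>2\<close>; \<open>u \<bullet> u\<close> is the squared Euclidean norm of \<open>u\<close>.\<close>

definition orth_proj_mat :: "real vec \<Rightarrow> real mat" where
  "orth_proj_mat u =
     1\<^sub>m (dim_vec u) -
     (1 / (u \<bullet> u)) \<cdot>\<^sub>m (mat_of_cols (dim_vec u) [u] * mat_of_rows (dim_vec u) [u])"

text \<open>The matrix stored in the head of the arc leaving a node with matrix \<open>H\<close>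
  under the decision \<open>z\<close>, where \<open>True\<close> stands for 1 and \<open>False\<close> for 0.
  It is only used for matrices with at least one row.\<close>

definition dd_step :: "bool \<Rightarrow> real mat \<Rightarrow> real mat" where
  "dd_step z H =
     (let u = row H 0 in
      if z \<and> u \<noteq> 0\<^sub>v (dim_col H) then drop_first_row H * orth_proj_mat u
      else drop_first_row H)"

text \<open>A node is a pair of its layer and its matrix, so that nodes are identified exactly
  when they lie in the same layer and store equal matrices.\<close>

type_synonym dd_node = "nat \<times> real mat"

inductive_set dd_nodes :: "real mat \<Rightarrow> dd_node set" for F :: "real mat" where
  root: "(1, F) \<in> dd_nodes F"
| step: "(l, H) \<in> dd_nodes F \<Longrightarrow> l \<le> dim_row F \<Longrightarrow> (Suc l, dd_step z H) \<in> dd_nodes F"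

text \<open>An arc is a pair of its tail and its decision, so that the two arcs leaving a node
  are distinct even when they have the same head.\<close>

definition exact_dd :: "real mat \<Rightarrow> (dd_node, dd_node \<times> bool) pre_digraph" where
  "exact_dd F =
     \<lparr> verts = dd_nodes F,
       arcs = {((l, H), z) | l H z. (l, H) \<in> dd_nodes F \<and> l \<le> dim_row F},
       tail = fst,
       head = (\<lambda>((l, H), z). (Suc l, dd_step z H)) \<rparr>"

lemma wf_digraph_exact_dd: "wf_digraph (exact_dd F)"
  by unfold_locales (auto simp: exact_dd_def intro: dd_nodes.step)

lemma dd_nodes_carrier:
  assumes "(l, H) \<in> dd_nodes F"
  shows "1 \<le> l \<and> l \<le> dim_row F + 1 \<and> H \<in> carrier_mat (dim_row F + 1 - l) (dim_col F)"
  using assms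
  by induction (auto simp: dd_step_def drop_first_row_def orth_proj_mat_def Let_def)

end

theory Submission
  imports Defs "Jordan_Normal_Form.Determinant"
begin

text \<open>Call an arc effective if its decision is 1 and the first row \<open>u\<close> of its tail is nonzero. Only
  effective arcs change anything but the layer, so a node of layer \<open>l\<close> is determined by the set of
  effective layers below \<open>l\<close> on a path to it. The rows \<open>u\<close> met along effective arcs are nonzero and
  pairwise orthogonal, and the rows of the stored matrix are orthogonal to all of them. Hence
  there are at most \<open>m\<close> effective layers, and after \<open>m\<close> of them the stored matrix is zero. A layer
  therefore contains the zero matrix and at most as many further nodes as there are sets of fewer than
  \<open>m\<close> preceding layers, that is \<open>O(n\<^sup>m\<^sup>-\<^sup>1)\<close> nodes.\<close>

section \<open>Projections and orthogonal families\<close>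

lemma orth_proj_mat_carrier [simp]: "orth_proj_mat u \<in> carrier_mat (dim_vec u) (dim_vec u)"
  by (auto simp: orth_proj_mat_def)

text \<open>Used in two cases: for nonzero \<open>u\<close> the matrix sends \<open>u\<close> to
  zero, and it fixes every vector orthogonal to \<open>u\<close>.\<close>

lemma orth_proj_mat_mult_vec:
  assumes "w \<in> carrier_vec (dim_vec u)"
  shows "orth_proj_mat u *\<^sub>v w = w - ((u \<bullet> w) / (u \<bullet> u)) \<cdot>\<^sub>v u"
proof (rule eq_vecI)
  fix i assume "i < dim_vec (w - ((u \<bullet> w) / (u \<bullet> u)) \<cdot>\<^sub>v u)"
  then have i: "i < dim_vec u" by simp
  have "(orth_proj_mat u *\<^sub>v w) $ i =
      (\<Sum>j = 0..<dim_vec u. ((if i = j then 1 else 0) - u $ i * u $ j / (u \<bullet> u)) * w $ j)"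
    using i assms
    by (auto simp: orth_proj_mat_def scalar_prod_def mat_of_cols_def mat_of_rows_def
        intro!: sum.cong)
  also have "\<dots> = (\<Sum>j = 0..<dim_vec u. (if i = j then w $ j else 0) -
      u $ i / (u \<bullet> u) * (u $ j * w $ j))"
    by (intro sum.cong) (auto simp: algebra_simps)
  also have "\<dots> = w $ i - u $ i / (u \<bullet> u) * (u \<bullet> w)"
    using i assms by (simp add: sum_subtractf sum_distrib_left scalar_prod_def)
  finally show "(orth_proj_mat u *\<^sub>v w) $ i = (w - ((u \<bullet> w) / (u \<bullet> u)) \<cdot>\<^sub>v u) $ i"
    using i assms by simp
qed (simp add: orth_proj_mat_def)

lemma drop_first_row_carrier:
  "H \<in> carrier_mat r c \<Longrightarrow> drop_first_row H \<in> carrier_mat (r - 1) c"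
  by (simp add: drop_first_row_def)

lemma drop_first_row_mult_vec_eq_0:
  assumes "H *\<^sub>v w = 0\<^sub>v (dim_row H)"
  shows "drop_first_row H *\<^sub>v w = 0\<^sub>v (dim_row H - 1)"
proof (rule eq_vecI)
  fix i assume i: "i < dim_vec (0\<^sub>v (dim_row H - 1) :: 'a vec)"
  then have "row (drop_first_row H) i = row H (Suc i)"
    by (auto simp: drop_first_row_def)
  then have "(drop_first_row H *\<^sub>v w) $ i = (H *\<^sub>v w) $ Suc i"
    using i by (simp add: drop_first_row_def)
  then show "(drop_first_row H *\<^sub>v w) $ i = 0\<^sub>v (dim_row H - 1) $ i"
    using i assms by simp
qed (simp add: drop_first_row_def)

text \<open>A nonzero \<open>r\<close> would be in the kernel of the square matrix with rows
  \<open>us\<close>, making its Gram matrix singular. But that Gram matrix is diagonal, with nonzero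
  diagonal because \<open>orthogonal\<close> excludes zero vectors.\<close>

lemma orthogonal_complement_of_orthogonal_list:
  fixes us :: "real vec list"
  assumes us: "set us \<subseteq> carrier_vec m" "orthogonal us" "length us = m"
    and r: "r \<in> carrier_vec m" "\<And>w. w \<in> set us \<Longrightarrow> w \<bullet> r = 0"
  shows "r = 0\<^sub>v m"
proof (rule ccontr)
  assume nz: "r \<noteq> 0\<^sub>v m"
  define U where "U = mat_of_rows m us"
  have U: "U \<in> carrier_mat m m"
    using us by (auto simp: U_def)
  have row: "row U i = us ! i" if "i < m" for i
    using that us by (simp add: U_def subset_iff)
  have "U *\<^sub>v r = 0\<^sub>v m"
    using U row r us by (intro eq_vecI) auto
  then have "det U = 0"
    using det_0_iff_vec_prod_zero[OF U] nz r by blast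
  then have det: "det (U * transpose_mat U) = 0"
    using U by (simp add: det_mult[of _ m])
  have *: "(U * transpose_mat U) $$ (i, j) = us ! i \<bullet> us ! j" if "i < m" "j < m" for i j
    using that U row by simp
  have "upper_triangular (U * transpose_mat U)"
    using us U * by (auto simp: orthogonal_def)
  moreover have "0 \<notin> set (diag_mat (U * transpose_mat U))"
    using us U * by (auto simp: diag_mat_def orthogonal_def simp del: index_mult_mat(1))
  ultimately show False
    using upper_triangular_imp_det_eq_0_iff[of "U * transpose_mat U" m] U det by auto
qed

lemma orthogonal_Cons:
  fixes u :: "real vec"
  assumes "orthogonal us" "u \<bullet> u \<noteq> 0"
    and "\<And>w. w \<in> set us \<Longrightarrow> u \<bullet> w = 0" "\<And>w. w \<in> set us \<Longrightarrow> w \<bullet> u = 0"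
  shows "orthogonal (u # us)"
  using assms by (auto simp: orthogonal_def nth_Cons split: nat.splits)

section \<open>Effective layers along a path\<close>

text \<open>Layers are shifted here: \<open>path_mat F E k\<close> is a matrix of layer \<open>k + 1\<close>, and \<open>k \<in> E\<close> is the
  decision taken there.\<close>

primrec path_mat :: "real mat \<Rightarrow> nat set \<Rightarrow> nat \<Rightarrow> real mat" where
  "path_mat F E 0 = F"
| "path_mat F E (Suc k) = dd_step (k \<in> E) (path_mat F E k)"

lemma path_mat_cong:
  "(\<And>i. i < k \<Longrightarrow> i \<in> E \<longleftrightarrow> i \<in> E') \<Longrightarrow> path_mat F E k = path_mat F E' k"
  by (induction k) simp_all

text \<open>The invariant along a path: \<open>E\<close> holds the effective layers (shifted by one)
  and \<open>us\<close> the rows \<open>u\<close> met there. As \<open>H\<close> annihilates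
  \<open>us\<close>, its first row is orthogonal to all of \<open>us\<close>, so it can extend the
  list.\<close>

lemma dd_nodes_effective:
  assumes "(l, H) \<in> dd_nodes F" "F \<in> carrier_mat n m"
  shows "\<exists>E us. E \<subseteq> {..<l - 1} \<and> H = path_mat F E (l - 1) \<and> card E = length us \<and> length us \<le> m \<and>
    set us \<subseteq> carrier_vec m \<and> orthogonal us \<and> (\<forall>w \<in> set us. H *\<^sub>v w = 0\<^sub>v (dim_row H))"
  using assms(1)
proof induction
  case root
  show ?case
    by (rule exI[of _ "{}"], rule exI[of _ "[]"]) (simp add: orthogonal_def)
next
  case (step l H z)
  from step.IH obtain E us where E: "E \<subseteq> {..<l - 1}" "H = path_mat F E (l - 1)"
    "card E = length us" and us: "length us \<le> m" "set us \<subseteq> carrier_vec m" "orthogonal us"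
    "\<And>w. w \<in> set us \<Longrightarrow> H *\<^sub>v w = 0\<^sub>v (dim_row H)"
    by blast
  have H: "H \<in> carrier_mat (n + 1 - l) m" and l: "1 \<le> l" "l \<le> n"
    using dd_nodes_carrier[OF step.hyps(1)] step.hyps(2) assms(2) by auto
  then have dH: "0 < dim_row H" by auto
  define k where "k = l - 1"
  have l_eq: "l = Suc k" using l by (simp add: k_def)
  have Ek: "E \<subseteq> {..<k}" "H = path_mat F E k" using E by (simp_all add: k_def)
  then have fin: "finite E" and notin: "k \<notin> E"
    by (auto intro: finite_subset)
  define u where "u = row H 0"
  have u: "u \<in> carrier_vec m" "dim_vec u = m"
    using H by (auto simp: u_def)
  have uw: "u \<bullet> w = 0" if "w \<in> set us" for w
    using arg_cong[OF us(4)[OF that], of "\<lambda>v. v $ 0"] dH by (simp add: u_def)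
  have wu: "w \<bullet> u = 0" if "w \<in> set us" for w
    using uw[OF that] comm_scalar_prod[OF u(1), of w] us(2) that by auto
  show ?case
  proof (cases "z \<and> u \<noteq> 0\<^sub>v m")
    \<comment> \<open>An ineffective arc acts as decision 0, even if \<open>z\<close> holds and
      \<open>u\<close> is zero, so \<open>E\<close> and \<open>us\<close> stay unchanged.\<close>
    case False
    then have st: "dd_step z H = drop_first_row H"
      using H by (auto simp: dd_step_def Let_def u_def)
    have "path_mat F E l = dd_step False H"
      using notin by (simp add: l_eq Ek(2))
    also have "\<dots> = drop_first_row H" by (simp add: dd_step_def)
    finally have "dd_step z H = path_mat F E l" using st by simp
    moreover have "\<forall>w \<in> set us. dd_step z H *\<^sub>v w = 0\<^sub>v (dim_row (dd_step z H))"
      using us(4) drop_first_row_mult_vec_eq_0[of H] st by (simp add: drop_first_row_def)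
    moreover have "E \<subseteq> {..<Suc l - 1}" using Ek(1) by (auto simp: l_eq)
    ultimately show ?thesis using E(3) us(1-3)
      by (intro exI[of _ E] exI[of _ us]) simp
  next
    case True
    let ?D = "drop_first_row H" and ?P = "orth_proj_mat u"
    have st: "dd_step z H = ?D * ?P"
      using H True by (auto simp: dd_step_def Let_def u_def)
    have D: "?D \<in> carrier_mat (dim_row H - 1) m"
      using H by (intro drop_first_row_carrier) auto
    have P: "?P \<in> carrier_mat m m"
      using orth_proj_mat_carrier[of u] u by simp
    have uu: "u \<bullet> u \<noteq> 0"
      using True u conjugate_square_eq_0_vec[of u m] by simp
    \<comment> \<open>A full list \<open>us\<close> would force \<open>u\<close> to be zero, so
      there is room for one more vector.\<close>
    have "length us \<noteq> m"
      using orthogonal_complement_of_orthogonal_list[OF us(2,3) _ u(1) wu] True by blast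
    then have len: "length (u # us) \<le> m" using us(1) by simp
    \<comment> \<open>The matrix at index \<open>k\<close> depends only on decisions before
      \<open>k\<close>.\<close>
    have "path_mat F (insert k E) k = H"
      unfolding Ek(2) by (rule path_mat_cong) auto
    then have "path_mat F (insert k E) l = dd_step True H"
      by (simp add: l_eq)
    then have pm: "dd_step z H = path_mat F (insert k E) l"
      using True by simp
    have ker: "dd_step z H *\<^sub>v w = 0\<^sub>v (dim_row (dd_step z H))" if w: "w \<in> set (u # us)" for w
    proof -
      have wc: "w \<in> carrier_vec m" using w u us(2) by auto
      have "?D *\<^sub>v (?P *\<^sub>v w) = 0\<^sub>v (dim_row H - 1)"
      proof (cases "w = u")
        case True
        then have "?P *\<^sub>v w = 0\<^sub>v m"
          using orth_proj_mat_mult_vec[of w u] uu u by auto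
        then show ?thesis using D by auto
      next
        case False
        then have "w \<in> set us" using w by simp
        then have "?P *\<^sub>v w = w"
          using orth_proj_mat_mult_vec[of w u] uw wc u by auto
        then show ?thesis
          using us(4)[OF \<open>w \<in> set us\<close>] drop_first_row_mult_vec_eq_0[of H w] by simp
      qed
      then show ?thesis
        using D P wc by (simp add: st)
    qed
    have "orthogonal (u # us)"
      using us(3) uu uw wu by (rule orthogonal_Cons)
    moreover have "insert k E \<subseteq> {..<Suc l - 1}"
      using Ek(1) by (auto simp: l_eq)
    moreover have "card (insert k E) = length (u # us)"
      using E(3) fin notin by simp
    ultimately show ?thesis
      using pm ker len u(1) us(2)
      by (intro exI[of _ "insert k E"] exI[of _ "u # us"]) auto
  qed
qed

text \<open>The first image covers nodes reached with fewer than \<open>m\<close> effective layers.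
  With exactly \<open>m\<close>, every row of \<open>H\<close> is orthogonal to \<open>m\<close>
  orthogonal nonzero vectors, so \<open>H\<close> is zero.\<close>

lemma dd_nodes_subset:
  assumes F: "F \<in> carrier_mat n m"
  shows "dd_nodes F \<subseteq>
    (\<lambda>(k, E). (Suc k, path_mat F E k)) ` ({..n} \<times> (\<Union>j<m. {E. E \<subseteq> {..<n} \<and> card E = j})) \<union>
    (\<lambda>k. (Suc k, 0\<^sub>m (n - k) m)) ` {..n}"
    (is "_ \<subseteq> ?f ` ?A \<union> ?g ` _")
proof
  fix x assume x: "x \<in> dd_nodes F"
  obtain l H where lH: "x = (l, H)" by (cases x)
  have l: "1 \<le> l" "l \<le> n + 1" and H: "H \<in> carrier_mat (n + 1 - l) m"
    using dd_nodes_carrier[OF x[unfolded lH]] F by auto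
  obtain E us where E: "E \<subseteq> {..<l - 1}" "H = path_mat F E (l - 1)" "card E = length us" and
    us: "length us \<le> m" "set us \<subseteq> carrier_vec m" "orthogonal us"
    "\<And>w. w \<in> set us \<Longrightarrow> H *\<^sub>v w = 0\<^sub>v (dim_row H)"
    using dd_nodes_effective[OF x[unfolded lH] F] by blast
  show "x \<in> ?f ` ?A \<union> ?g ` {..n}"
  proof (cases "length us = m")
    case True
    have "row H i = 0\<^sub>v m" if i: "i < dim_row H" for i
    proof (rule orthogonal_complement_of_orthogonal_list[OF us(2,3) True])
      show r: "row H i \<in> carrier_vec m" using H i by auto
      show "w \<bullet> row H i = 0" if w: "w \<in> set us" for w
      proof -
        have "row H i \<bullet> w = (H *\<^sub>v w) $ i" using i by simp
        also have "\<dots> = 0" using us(4)[OF w] i by simp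
        finally show ?thesis using comm_scalar_prod[OF r, of w] us(2) w by auto
      qed
    qed
    then have "H = 0\<^sub>m (n + 1 - l) m"
      using H by (intro eq_rowI) auto
    then have "x = ?g (l - 1)" using l lH by simp
    moreover have "l - 1 \<in> {..n}" using l by simp
    ultimately show ?thesis by blast
  next
    case False
    have "x = ?f (l - 1, E)" using l lH E(2) by simp
    moreover have "E \<subseteq> {..<n}" using E(1) l by auto
    then have "(l - 1, E) \<in> ?A" using l E(3) False us(1) by simp
    ultimately show ?thesis by blast
  qed
qed

section \<open>Counting nodes\<close>

text \<open>Each of the \<open>m\<close> sizes \<open>j < m\<close> contributes
  \<open>n choose j\<close>, which is at most \<open>n ^ j\<close> and hence at most
  \<open>n ^ (m - 1)\<close>.\<close>

lemma card_small_subsets_le: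
  assumes "1 \<le> n"
  shows "card (\<Union>j<m. {E. E \<subseteq> {..<n} \<and> card E = j}) \<le> m * n ^ (m - 1)"
proof -
  have "card (\<Union>j<m. {E. E \<subseteq> {..<n} \<and> card E = j}) \<le>
      (\<Sum>j<m. card {E. E \<subseteq> {..<n} \<and> card E = j})"
    by (rule card_UN_le) simp
  also have "\<dots> = (\<Sum>j<m. n choose j)"
    by (simp add: n_subsets)
  also have "\<dots> \<le> (\<Sum>j<m. n ^ (m - 1))"
  proof (rule sum_mono)
    fix j assume j: "j \<in> {..<m}"
    have "n choose j \<le> n ^ j"
      by (cases "j \<le> n") (auto simp: binomial_le_pow binomial_eq_0)
    also have "\<dots> \<le> n ^ (m - 1)"
      using assms j by (intro power_increasing) auto
    finally show "n choose j \<le> n ^ (m - 1)" .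
  qed
  finally show ?thesis by simp
qed

lemma dd_nodes_card:
  assumes F: "F \<in> carrier_mat n m" and "1 \<le> n"
  shows "finite (dd_nodes F)" "card (dd_nodes F) \<le> (n + 1) * (m * n ^ (m - 1) + 1)"
proof -
  let ?S = "\<Union>j<m. {E. E \<subseteq> {..<n} \<and> card E = j}"
  let ?A = "(\<lambda>(k, E). (Suc k, path_mat F E k)) ` ({..n} \<times> ?S)"
    and ?B = "(\<lambda>k. (Suc k, 0\<^sub>m (n - k) m)) ` {..n} :: (nat \<times> real mat) set"
  have "finite ?S"
    by (rule finite_subset[of _ "Pow {..<n}"]) auto
  then have fin: "finite ({..n} \<times> ?S)" by blast
  then have fin': "finite (?A \<union> ?B)" by blast
  then show "finite (dd_nodes F)"
    by (rule finite_subset[OF dd_nodes_subset[OF F]])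
  have "card (dd_nodes F) \<le> card (?A \<union> ?B)"
    by (rule card_mono[OF fin' dd_nodes_subset[OF F]])
  also have "\<dots> \<le> card ?A + card ?B" by (rule card_Un_le)
  also have "\<dots> \<le> card ({..n} \<times> ?S) + card {..n}"
    by (intro add_mono card_image_le fin finite_atMost)
  also have "\<dots> = (n + 1) * (card ?S + 1)"
    by (simp add: card_cartesian_product algebra_simps)
  also have "\<dots> \<le> (n + 1) * (m * n ^ (m - 1) + 1)"
    using card_small_subsets_le[OF \<open>1 \<le> n\<close>, of m] by (intro mult_le_mono add_mono) auto
  finally show "card (dd_nodes F) \<le> (n + 1) * (m * n ^ (m - 1) + 1)" .
qed

theorem proposition8:
  fixes m :: nat
  assumes "m \<ge> 1"
  shows "\<exists>C :: real. \<forall>n \<ge> 1. \<forall>F \<in> carrier_mat n m.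
    finite (verts (exact_dd F)) \<and> real (card (verts (exact_dd F))) \<le> C * real n ^ m"
proof (intro exI allI impI ballI conjI)
  fix n :: nat and F :: "real mat"
  assume n: "1 \<le> n" and F: "F \<in> carrier_mat n m"
  show "finite (verts (exact_dd F))"
    using dd_nodes_card[OF F n] by (simp add: exact_dd_def)
  have "card (dd_nodes F) \<le> (n + 1) * (m * n ^ (m - 1) + 1)"
    by (rule dd_nodes_card[OF F n])
  \<comment> \<open>Since \<open>n\<close> is at least 1, both summands 1 are absorbed; this leads
    to the constant \<open>2 * (m + 1)\<close>, fixed as the witness only by the last
    \<open>show\<close>.\<close>
  also have "\<dots> \<le> (2 * n) * (m * n ^ (m - 1) + n ^ (m - 1))"
    using n by (intro mult_le_mono add_mono) auto
  also have "\<dots> = 2 * (m + 1) * (n * n ^ (m - 1))"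
    by (simp add: algebra_simps)
  also have "n * n ^ (m - 1) = n ^ m"
    using assms by (simp add: power_eq_if)
  finally have "real (card (dd_nodes F)) \<le> real (2 * (m + 1) * n ^ m)"
    by (simp only: of_nat_le_iff)
  then show "real (card (verts (exact_dd F))) \<le> real (2 * (m + 1)) * real n ^ m"
    by (simp add: exact_dd_def distrib_right)
qed

end
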